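(* Let $\theta>0$ and let $A,B,C,D,E$ be real functions on $[-\theta,\theta]$ with $A,C,D,E$ even and $B$ odd, and let $\{\lambda_n\}_{n\ge 0}$ be a sequence of constants. Put $$R(x)=\exp\Big(\int\frac{B(x)-A'(x)}{A(x)}\,dx\Big)=\frac{1}{A(x)}\exp\Big(\int\frac{B(x)}{A(x)}\,dx\Big),\qquad W^*(x)=C(x)R(x)=C(x)\exp\Big(\int\frac{B(x)-A'(x)}{A(x)}\,dx\Big).$$ Assume that $x=\theta$ is a root of the function $A(x)R(x)$ and that $W^*$ is a positive and even function on $[-\theta,\theta]$. Let $\{\Phi_n\}_{n\ge 0}$ be a sequence of functions with the symmetry property $\Phi_n(x)=(-1)^n\Phi_n(-x)$ such that, for every $n$, $\Phi_n$ satisfies on $[-\theta,\theta]$ the differential equation $$A(x)\Phi_n''(x)+B(x)\Phi_n'(x)+\Big(\lambda_n C(x)+D(x)+\frac{1-(-1)^n}{2}E(x)\Big)\Phi_n(x)=0 .$$ Then for all $n,m\ge 0$ $$\int_{-\theta}^{\theta}W^*(x)\Phi_n(x)\Phi_m(x)\,dx=\Big(\int_{-\theta}^{\theta}W^*(x)\Phi_n^2(x)\,dx\Big)\delta_{n,m}.$$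
   Context: $\delta_{n,m}$ is the Kronecker delta ($1$ if $n=m$, $0$ if $n\neq m$). The function $R$ is the even positive integrating factor that puts the differential equation into the self-adjoint form $\frac{d}{dx}\big(A R\,\Phi_n'\big)=-(\lambda_n C+D)R\,\Phi_n-\frac{1-(-1)^n}{2}E R\,\Phi_n$; the indefinite integral in it denotes an antiderivative chosen so that $R$ is even. The functions are understood to be regular enough for all displayed expressions to make sense.
   Formalization: Added: λ_n ≠ λ_m for n ≠ m of equal parity (else false: Legendre equation, all λ_n = 0, Φ_0 = Φ_2 = 1). A may have finitely many interior zeros, where R is undefined; there x·A(x)R(x) must have a limit (automatic where A ≠ 0). *)

theory Defs
  imports "HOL-Analysis.Analysis"
begin

definition even_on :: "real set \<Rightarrow> (real \<Rightarrow> real) \<Rightarrow> bool" where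
  "even_on S f \<longleftrightarrow> (\<forall>x\<in>S. f (- x) = f x)"

definition odd_on :: "real set \<Rightarrow> (real \<Rightarrow> real) \<Rightarrow> bool" where
  "odd_on S f \<longleftrightarrow> (\<forall>x\<in>S. f (- x) = - f x)"

(* The points at which the quotients by A make sense.  The endpoints are left out because
   (B - A') / A is typically singular there; zeros of A inside the interval are left out
   because they occur in the standard examples, e.g. A(x) = x^2 (p x^2 + q). *)
definition regular_points :: "real \<Rightarrow> (real \<Rightarrow> real) \<Rightarrow> real set" where
  "regular_points \<theta> A = {x \<in> {-\<theta><..<\<theta>}. A x \<noteq> 0}"

(* R = exp H for an antiderivative H of (B - A') / A, chosen so that R is even.  The values of
   R outside the regular points are unconstrained. *)
definition even_integrating_factor ::
  "real \<Rightarrow> (real \<Rightarrow> real) \<Rightarrow> (real \<Rightarrow> real) \<Rightarrow> (real \<Rightarrow> real) \<Rightarrow> (real \<Rightarrow> real) \<Rightarrow> bool" where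
  "even_integrating_factor \<theta> A A' B R \<longleftrightarrow>
     (\<exists>H. (\<forall>x\<in>regular_points \<theta> A. (H has_real_derivative (B x - A' x) / A x) (at x)) \<and>
          (\<forall>x\<in>regular_points \<theta> A. R x = exp (H x))) \<and>
     even_on (regular_points \<theta> A) R"

definition weight :: "(real \<Rightarrow> real) \<Rightarrow> (real \<Rightarrow> real) \<Rightarrow> real \<Rightarrow> real" where
  "weight C R x = C x * R x"

(* "A R has the root \<theta>": A R is in general only defined in the interior, so its value at \<theta> is
   the limit from inside.  (With R(x) = exp(...) > 0, a condition on the function values at \<theta>
   itself would only say that A(\<theta>) = 0.) *)
definition root_at_right_end :: "real \<Rightarrow> (real \<Rightarrow> real) \<Rightarrow> bool" where
  "root_at_right_end \<theta> P \<longleftrightarrow> (P \<longlongrightarrow> 0) (at_left \<theta>)"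

(* Regularity of P = A R at interior points.  At points where A does not vanish it holds
   automatically, and it follows whenever A R extends continuously to the open interval.
   At z \<noteq> 0 it says exactly that A R has a limit at z.  The factor x only matters at the centre
   z = 0, where it also admits |x|^s with -1 < s < 0 (the whole integrable range); without
   any condition at a zero of A the boundary terms there need not cancel. *)
definition interior_regular :: "real \<Rightarrow> (real \<Rightarrow> real) \<Rightarrow> bool" where
  "interior_regular \<theta> P \<longleftrightarrow> (\<forall>z\<in>{-\<theta><..<\<theta>}. \<exists>l. ((\<lambda>x. x * P x) \<longlongrightarrow> l) (at z))"

(* The second expression for R, (1/A) exp (\<integral> B/A); the absolute value is the usual one in
   the antiderivative of A'/A and disappears when A > 0. *)
lemma even_integrating_factor_alt:
  assumes R: "even_integrating_factor \<theta> A A' B R"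
    and A: "\<And>x. x \<in> {-\<theta><..<\<theta>} \<Longrightarrow> (A has_real_derivative A' x) (at x)"
  shows "\<exists>G. \<forall>x\<in>regular_points \<theta> A.
           (G has_real_derivative B x / A x) (at x) \<and> R x = 1 / \<bar>A x\<bar> * exp (G x)"
proof -
  obtain H where
    H: "\<And>x. x \<in> regular_points \<theta> A \<Longrightarrow> (H has_real_derivative (B x - A' x) / A x) (at x)"
    and RH: "\<And>x. x \<in> regular_points \<theta> A \<Longrightarrow> R x = exp (H x)"
    using R unfolding even_integrating_factor_def by blast
  have "((\<lambda>x. H x + ln ((A x)\<^sup>2) / 2) has_real_derivative B x / A x) (at x) \<and>
        R x = 1 / \<bar>A x\<bar> * exp (H x + ln ((A x)\<^sup>2) / 2)"
    if x: "x \<in> regular_points \<theta> A" for x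
  proof
    have nz: "A x \<noteq> 0" and Ax: "(A has_real_derivative A' x) (at x)"
      using x A by (auto simp: regular_points_def)
    show "((\<lambda>x. H x + ln ((A x)\<^sup>2) / 2) has_real_derivative B x / A x) (at x)"
      using nz
      by (auto intro!: derivative_eq_intros H[OF x] Ax simp: field_simps power2_eq_square zero_less_mult_iff)
    have "ln ((A x)\<^sup>2) / 2 = ln \<bar>A x\<bar>"
      using nz ln_realpow[of "\<bar>A x\<bar>" 2] by simp
    then show "R x = 1 / \<bar>A x\<bar> * exp (H x + ln ((A x)\<^sup>2) / 2)"
      using nz RH[OF x] by (simp add: exp_add)
  qed
  then show ?thesis by (intro exI[of _ "\<lambda>x. H x + ln ((A x)\<^sup>2) / 2"]) blast
qed

end

(* For equal parity, G = A R (\<Phi>\<^sub>n' \<Phi>\<^sub>m - \<Phi>\<^sub>n \<Phi>\<^sub>m') has derivative (\<lambda>\<^sub>m - \<lambda>\<^sub>n) W \<Phi>\<^sub>n \<Phi>\<^sub>m at every regular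
   point, because (A R)' = B R there.  It extends continuously to the closed interval: at a zero
   z \<noteq> 0 of A since A R has a limit, at 0 since the Wronskian is odd and hence O(x) while x A R
   has a limit, and at \<plusminus>\<theta> with value 0 since A R tends to 0.  So the fundamental theorem of
   calculus gives integral 0.  For opposite parity the integrand is odd. *)
theory Submission
  imports Defs
begin

text \<open>This serves to discard the zeros of \<open>A\<close>, the endpoints and the centre
  inside limits. A finite set is closed, and the punctured filter ignores the point z
  itself.\<close>

lemma eventually_at_within_cofinite:
  fixes z :: "'a::t1_space"
  assumes "finite S"
  shows "eventually (\<lambda>x. x \<in> T - S) (at z within T)"
proof -
  \<comment> \<open>Leaving z out of the removed set makes its complement a neighbourhood of z even
    when z lies in \<open>S\<close>.\<close>
  have "open (- (S - {z}))"
    using assms by (intro open_Compl finite_imp_closed) simp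
  then show ?thesis
    unfolding eventually_at_topological by (intro exI[of _ "- (S - {z})"]) auto
qed

text \<open>The values of \<open>f\<close> on \<open>S\<close> and at the endpoints may be
  arbitrary, as those of \<open>R\<close> are at zeros of \<open>A\<close>. Replacing
  \<open>f\<close> by its limit at every point gives a continuous function with the same derivative
  off \<open>S\<close>, to which the fundamental theorem with finitely many exceptional points
  applies.\<close>

lemma has_integral_of_derivative_with_limits:
  fixes f f' :: "real \<Rightarrow> real"
  assumes ab: "a < b" and S: "finite S"
    and deriv: "\<And>x. x \<in> {a<..<b} - S \<Longrightarrow> (f has_real_derivative f' x) (at x)"
    and lims: "\<And>z. z \<in> {a..b} \<Longrightarrow> \<exists>l. (f \<longlongrightarrow> l) (at z within {a..b})"
    and la: "(f \<longlongrightarrow> la) (at_right a)" and lb: "(f \<longlongrightarrow> lb) (at_left b)"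
  shows "(f' has_integral (lb - la)) {a..b}"
proof -
  define g where "g = (\<lambda>z. Lim (at z within {a..b}) f)"
  have nontriv: "at z within {a..b} \<noteq> bot" if "z \<in> {a..b}" for z
    using that ab by (simp add: trivial_limit_within islimpt_Icc)
  have lim: "(f \<longlongrightarrow> g z) (at z within {a..b})" if "z \<in> {a..b}" for z
    using lims[OF that] tendsto_Lim[OF nontriv[OF that]] by (auto simp: g_def)
  have gf: "g x = f x" if x: "x \<in> {a<..<b} - S" for x
  proof -
    have "(f \<longlongrightarrow> f x) (at x within {a..b})"
      using DERIV_isCont[OF deriv[OF x]] by (auto simp: isCont_def intro: tendsto_within_subset)
    then show ?thesis
      using x lim[of x] nontriv[of x] tendsto_unique by fastforce
  qed
  have cont: "continuous_on {a..b} g"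
    unfolding continuous_on_def
  proof
    fix z assume z: "z \<in> {a..b}"
    \<comment> \<open>Near z the functions \<open>f\<close> and \<open>g\<close> agree off a finite
      set, so the limit of \<open>f\<close> at z, which is \<open>g z\<close>, is also the limit of
      \<open>g\<close>.\<close>
    have "eventually (\<lambda>x. x \<in> {a..b} - (S \<union> {a, b})) (at z within {a..b})"
      using S by (intro eventually_at_within_cofinite) auto
    then have "eventually (\<lambda>x. f x = g x) (at z within {a..b})"
      by eventually_elim (use gf in auto)
    then show "(g \<longlongrightarrow> g z) (at z within {a..b})"
      using lim[OF z] by (rule Lim_transform_eventually[rotated])
  qed
  have op: "open ({a<..<b} - S)"
    using S by (intro open_Diff) (auto intro: finite_imp_closed)
  have "(f' has_integral (g b - g a)) {a..b}"
  proof (rule fundamental_theorem_of_calculus_interior_strong[OF S])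
    fix x assume x: "x \<in> {a<..<b} - S"
    have "(g has_real_derivative f' x) (at x)"
      by (rule has_field_derivative_transform_within_open[OF deriv[OF x] op x]) (use gf in auto)
    then show "(g has_vector_derivative f' x) (at x)"
      by (simp add: has_real_derivative_iff_has_vector_derivative)
  qed (use ab cont in auto)
  moreover have "g a = la"
    using lim[of a] la ab tendsto_unique[of "at_right a"] by (simp add: at_within_Icc_at_right)
  moreover have "g b = lb"
    using lim[of b] lb ab tendsto_unique[of "at_left b"] by (simp add: at_within_Icc_at_left)
  ultimately show ?thesis by simp
qed

text \<open>Reflection, changes on a finite set and negation hold for \<open>integral\<close>
  without integrability, since its default value 0 respects them. Hence the integral equals its own
  negative.\<close>

lemma integral_odd_almost_everywhere:
  fixes f :: "real \<Rightarrow> real"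
  assumes S: "finite S" and odd: "\<And>x. x \<in> {-a..a} - S \<Longrightarrow> f (- x) = - f x"
  shows "integral {-a..a} f = 0"
proof -
  have "integral {-a..a} f = integral {-a..a} (\<lambda>x. f (- x))"
    using Henstock_Kurzweil_Integration.integral_reflect_real[of a "-a" f] by simp
  also have "\<dots> = integral {-a..a} (\<lambda>x. - f x)"
    by (rule integral_spike[of S]) (use odd S in auto)
  finally show ?thesis by simp
qed

text \<open>Reflecting \<open>f\<close> turns the derivative at 0 into \<open>- d\<close>, while
  evenness leaves \<open>f\<close> unchanged near 0; uniqueness gives d = -d.\<close>

lemma derivative_at_0_of_even:
  fixes f :: "real \<Rightarrow> real"
  assumes a: "a > 0" and ev: "\<And>x. x \<in> {-a<..<a} \<Longrightarrow> f (- x) = f x"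
    and d: "(f has_real_derivative d) (at 0)"
  shows "d = 0"
proof -
  have "((\<lambda>x. f (- x)) has_real_derivative - d) (at 0)"
    using d DERIV_mirror[of f d 0] by simp
  then have "(f has_real_derivative - d) (at 0)"
    by (rule has_field_derivative_transform_within_open[of _ _ _ "{-a<..<a}"]) (use a ev in auto)
  from DERIV_unique[OF d this] show ?thesis
    by simp
qed

theorem theorem1:
  fixes \<theta> :: real
    and A A' B C D E R :: "real \<Rightarrow> real"
    and lam :: "nat \<Rightarrow> real"
    and \<Phi> \<Phi>' \<Phi>'' :: "nat \<Rightarrow> real \<Rightarrow> real"
  assumes theta: "\<theta> > 0"
    and parity: "even_on {-\<theta>..\<theta>} A" "odd_on {-\<theta>..\<theta>} B" "even_on {-\<theta>..\<theta>} C"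
      "even_on {-\<theta>..\<theta>} D" "even_on {-\<theta>..\<theta>} E"
    and A_deriv: "\<And>x. x \<in> {-\<theta><..<\<theta>} \<Longrightarrow> (A has_real_derivative A' x) (at x)"
    and A_zeros: "finite {x \<in> {-\<theta><..<\<theta>}. A x = 0}"
    and R: "even_integrating_factor \<theta> A A' B R"
    and AR_regular: "interior_regular \<theta> (\<lambda>x. A x * R x)"
    and AR_root: "root_at_right_end \<theta> (\<lambda>x. A x * R x)"
    and W_pos: "\<And>x. x \<in> regular_points \<theta> A \<Longrightarrow> weight C R x > 0"
    and W_even: "even_on (regular_points \<theta> A) (weight C R)"
    and distinct_eigenvalues: "\<And>n m. n \<noteq> m \<Longrightarrow> even n = even m \<Longrightarrow> lam n \<noteq> lam m"
    and Phi_symm: "\<And>n x. x \<in> {-\<theta>..\<theta>} \<Longrightarrow> \<Phi> n x = (-1) ^ n * \<Phi> n (- x)"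
    and Phi_deriv: "\<And>n x. x \<in> {-\<theta>..\<theta>} \<Longrightarrow>
      (\<Phi> n has_real_derivative \<Phi>' n x) (at x within {-\<theta>..\<theta>})"
    and Phi_deriv2: "\<And>n x. x \<in> {-\<theta>..\<theta>} \<Longrightarrow>
      (\<Phi>' n has_real_derivative \<Phi>'' n x) (at x within {-\<theta>..\<theta>})"
    and ode: "\<And>n x. x \<in> {-\<theta>..\<theta>} \<Longrightarrow>
      A x * \<Phi>'' n x + B x * \<Phi>' n x
        + (lam n * C x + D x + (1 - (-1) ^ n) / 2 * E x) * \<Phi> n x = 0"
  shows "\<forall>n m. integral {-\<theta>..\<theta>} (\<lambda>x. weight C R x * \<Phi> n x * \<Phi> m x)
             = integral {-\<theta>..\<theta>} (\<lambda>x. weight C R x * (\<Phi> n x)\<^sup>2) * (if n = m then 1 else 0)"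
proof (intro allI)
  fix n m :: nat
  define I where "I = {-\<theta>..\<theta>}"
  define Z where "Z = {x \<in> {-\<theta><..<\<theta>}. A x = 0}"
  define P where "P = (\<lambda>x. A x * R x)"
  have finZ: "finite Z"
    using A_zeros by (simp add: Z_def)
  have reg: "regular_points \<theta> A = {-\<theta><..<\<theta>} - Z"
    by (auto simp: regular_points_def Z_def)
  have opreg: "open (regular_points \<theta> A)"
    unfolding reg using finZ by (intro open_Diff) (auto intro: finite_imp_closed)
  have zero: "integral I (\<lambda>x. weight C R x * \<Phi> n x * \<Phi> m x) = 0" if nm: "n \<noteq> m"
  proof (cases "even n = even m")
    case False
    show ?thesis
      unfolding I_def
    \<comment> \<open>Evenness of the weight is known at regular points only, so the endpoints are
      excluded along with the zeros of \<open>A\<close>.\<close>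
    proof (rule integral_odd_almost_everywhere[of "Z \<union> {-\<theta>, \<theta>}"])
      fix x assume x: "x \<in> {-\<theta>..\<theta>} - (Z \<union> {-\<theta>, \<theta>})"
      then have "x \<in> regular_points \<theta> A"
        by (auto simp: reg)
      then have "weight C R (- x) = weight C R x"
        using W_even by (auto simp: even_on_def)
      moreover have "\<Phi> n x * \<Phi> m x = - (\<Phi> n (- x) * \<Phi> m (- x))"
        using False x Phi_symm[of x n] Phi_symm[of x m] by (cases "even n") auto
      ultimately show "weight C R (- x) * \<Phi> n (- x) * \<Phi> m (- x)
          = - (weight C R x * \<Phi> n x * \<Phi> m x)"
        by (simp add: mult.assoc)
    qed (use finZ in auto)
  next
    case True
    define w where "w = (\<lambda>x. \<Phi>' n x * \<Phi> m x - \<Phi> n x * \<Phi>' m x)"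
    define w' where "w' = (\<lambda>x. \<Phi>'' n x * \<Phi> m x - \<Phi> n x * \<Phi>'' m x)"
    have w_deriv: "(w has_real_derivative w' x) (at x within I)" if "x \<in> I" for x
      unfolding w_def w'_def I_def
      by (rule derivative_eq_intros Phi_deriv Phi_deriv2 refl | use that in \<open>simp add: I_def\<close>)+
    have at_I: "at x within I = at x" if "x \<in> {-\<theta><..<\<theta>}" for x
      using that unfolding I_def by (simp add: at_within_Icc_at)
    have P_deriv: "(P has_real_derivative B x * R x) (at x)" if x: "x \<in> regular_points \<theta> A" for x
    proof -
      obtain H where
        H: "\<And>x. x \<in> regular_points \<theta> A \<Longrightarrow> (H has_real_derivative (B x - A' x) / A x) (at x)"
        and RH: "\<And>x. x \<in> regular_points \<theta> A \<Longrightarrow> R x = exp (H x)"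
        using R unfolding even_integrating_factor_def by blast
      have x': "x \<in> {-\<theta><..<\<theta>}" "A x \<noteq> 0"
        using x by (auto simp: regular_points_def)
      \<comment> \<open>In the product rule the term A' exp H cancels against the -A' contained in A
        H' = B - A'.\<close>
      have "((\<lambda>x. A x * exp (H x)) has_real_derivative B x * R x) (at x)"
        by (rule derivative_eq_intros A_deriv[OF x'(1)] H[OF x] refl)+
          (use x'(2) RH[OF x] in \<open>simp add: field_simps\<close>)
      then show ?thesis
        by (rule has_field_derivative_transform_within_open[OF _ opreg x]) (use RH in \<open>simp add: P_def\<close>)
    qed
    have G_deriv: "((\<lambda>x. P x * w x) has_real_derivative
        (lam m - lam n) * (weight C R x * \<Phi> n x * \<Phi> m x)) (at x)"
      if x: "x \<in> {-\<theta><..<\<theta>} - Z" for x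
    proof -
      have xI: "x \<in> I"
        using x by (auto simp: I_def)
      have "(w has_real_derivative w' x) (at x)"
        using w_deriv[OF xI] at_I x by simp
      then have "((\<lambda>x. P x * w x) has_real_derivative B x * R x * w x + w' x * P x) (at x)"
        using x by (intro DERIV_mult P_deriv) (auto simp: reg)
      moreover have "B x * R x * w x + w' x * P x
          = (lam m - lam n) * (weight C R x * \<Phi> n x * \<Phi> m x)"
      proof -
        have par: "(-1) ^ n = ((-1) ^ m :: real)"
          using True by (cases "even n") auto
        \<comment> \<open>By \<open>par\<close> the \<open>E\<close> terms of both equations equal
          \<open>q\<close>. After cross-multiplication \<open>D\<close> and \<open>q\<close> cancel,
          and only the difference of the eigenvalues times \<open>C\<close> survives.\<close>
        define q where "q = (1 - (-1) ^ m) / 2 * E x"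
        have n_eq: "A x * \<Phi>'' n x + B x * \<Phi>' n x = - ((lam n * C x + D x + q) * \<Phi> n x)"
          using ode[of x n] xI par by (simp add: q_def I_def eq_neg_iff_add_eq_0 )
        have m_eq: "A x * \<Phi>'' m x + B x * \<Phi>' m x = - ((lam m * C x + D x + q) * \<Phi> m x)"
          using ode[of x m] xI by (simp add: q_def I_def eq_neg_iff_add_eq_0 )
        have "B x * R x * w x + w' x * P x
          = R x * ((A x * \<Phi>'' n x + B x * \<Phi>' n x) * \<Phi> m x
                   - (A x * \<Phi>'' m x + B x * \<Phi>' m x) * \<Phi> n x)"
          by (simp add: w_def w'_def P_def algebra_simps)
        also have "\<dots> = (lam m - lam n) * (weight C R x * \<Phi> n x * \<Phi> m x)"
          unfolding n_eq m_eq weight_def by algebra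
        finally show ?thesis .
      qed
      ultimately show ?thesis by simp
    qed
    have w_tendsto: "(w \<longlongrightarrow> w x) (at x within I)" if "x \<in> I" for x
      using DERIV_continuous[OF w_deriv[OF that]] by (simp add: continuous_within)
    have G_right_end: "((\<lambda>x. P x * w x) \<longlongrightarrow> 0) (at_left \<theta>)"
    proof -
      have "(P \<longlongrightarrow> 0) (at_left \<theta>)"
        using AR_root by (simp add: root_at_right_end_def P_def)
      moreover have "(w \<longlongrightarrow> w \<theta>) (at_left \<theta>)"
        using w_tendsto[of \<theta>] theta by (simp add: I_def at_within_Icc_at_left)
      ultimately show ?thesis
        using tendsto_mult by fastforce
    qed
    have G_left_end: "((\<lambda>x. P x * w x) \<longlongrightarrow> 0) (at_right (- \<theta>))"
    proof -
      \<comment> \<open>Since \<open>Z\<close> is finite, all points close enough to \<theta> from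
        the left are regular. There \<open>A\<close> and \<open>R\<close> are even, so the limit of
        \<open>P\<close> at \<theta> carries over to -\<theta>.\<close>
      have "eventually (\<lambda>x. x \<in> I - (Z \<union> {-\<theta>, \<theta>})) (at \<theta> within I)"
        using finZ by (intro eventually_at_within_cofinite) auto
      then have "eventually (\<lambda>x. P x = P (- x)) (at_left \<theta>)"
        unfolding I_def at_within_Icc_at_left[of "-\<theta>" \<theta>, simplified, OF theta]
      proof eventually_elim
        case (elim x)
        then have "x \<in> regular_points \<theta> A"
          by (auto simp: reg)
        then show ?case
          using R parity(1) elim by (auto simp: even_integrating_factor_def even_on_def P_def)
      qed
      moreover have "(P \<longlongrightarrow> 0) (at_left \<theta>)"
        using AR_root by (simp add: root_at_right_end_def P_def)
      ultimately have "((\<lambda>x. P (- x)) \<longlongrightarrow> 0) (at_left \<theta>)"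
        by (rule Lim_transform_eventually[rotated])
      then have "(P \<longlongrightarrow> 0) (at_right (- \<theta>))"
        by (simp add: at_right_minus filterlim_filtermap)
      moreover have "(w \<longlongrightarrow> w (- \<theta>)) (at_right (- \<theta>))"
        using w_tendsto[of "-\<theta>"] theta by (simp add: I_def at_within_Icc_at_right)
      ultimately show ?thesis
        using tendsto_mult by fastforce
    qed
    \<comment> \<open>Each product in \<open>w\<close> has a factor vanishing at 0: the derivative
      when both functions are even, the function itself when both are odd.\<close>
    have w0: "w 0 = 0"
    proof (cases "even n")
      case True
      have "\<Phi>' k 0 = 0" if "even k" for k
      proof (rule derivative_at_0_of_even[OF theta])
        show "(\<Phi> k has_real_derivative \<Phi>' k 0) (at 0)"
          using Phi_deriv[of 0 k] theta at_I[of 0] by (simp add: I_def)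
        show "\<Phi> k (- x) = \<Phi> k x" if "x \<in> {-\<theta><..<\<theta>}" for x
          using that \<open>even k\<close> Phi_symm[of x k] by simp
      qed
      then show ?thesis
        using True \<open>even n = even m\<close> by (simp add: w_def)
    next
      case False
      then show ?thesis
        using \<open>even n = even m\<close> Phi_symm[of 0 n] Phi_symm[of 0 m] theta by (simp add: w_def)
    qed
    have G_interior: "\<exists>l. ((\<lambda>x. P x * w x) \<longlongrightarrow> l) (at z)" if z: "z \<in> {-\<theta><..<\<theta>}" for z
    proof -
      obtain l where l: "((\<lambda>x. x * P x) \<longlongrightarrow> l) (at z)"
        using AR_regular z unfolding interior_regular_def P_def by blast
      have zI: "z \<in> I"
        using z by (auto simp: I_def)
      \<comment> \<open>The product is split as P w = (x P)(w / x). At 0 the second factor is the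
        difference quotient of \<open>w\<close>, because \<open>w 0 = 0\<close>; elsewhere it is
        continuous.\<close>
      obtain d where d: "((\<lambda>x. w x / x) \<longlongrightarrow> d) (at z)"
      proof (cases "z = 0")
        case True
        have "(w has_real_derivative w' 0) (at 0)"
          using w_deriv[OF zI] at_I[OF z] True by simp
        then show ?thesis
          using that True w0 by (simp add: has_field_derivative_iff)
      next
        case False
        have "((\<lambda>x. w x / x) \<longlongrightarrow> w z / z) (at z)"
          using w_tendsto[OF zI] at_I[OF z] False by (auto intro!: tendsto_intros)
        then show ?thesis
          by (rule that)
      qed
      have "((\<lambda>x. x * P x * (w x / x)) \<longlongrightarrow> l * d) (at z)"
        by (intro tendsto_mult l d)
      moreover have "eventually (\<lambda>x. x * P x * (w x / x) = P x * w x) (at z)"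
        using eventually_at_within_cofinite[OF finite.insertI[OF finite.emptyI, of 0], of UNIV z] by eventually_elim auto
      ultimately have "((\<lambda>x. P x * w x) \<longlongrightarrow> l * d) (at z)"
        by (rule Lim_transform_eventually)
      then show ?thesis
        by (rule exI)
    qed
    have "((\<lambda>x. (lam m - lam n) * (weight C R x * \<Phi> n x * \<Phi> m x)) has_integral (0 - 0)) {-\<theta>..\<theta>}"
    proof (rule has_integral_of_derivative_with_limits[OF _ finZ G_deriv _ G_left_end G_right_end])
      fix z assume "z \<in> {-\<theta>..\<theta>}"
      then consider "z = -\<theta>" | "z = \<theta>" | "z \<in> {-\<theta><..<\<theta>}"
        by fastforce
      then show "\<exists>l. ((\<lambda>x. P x * w x) \<longlongrightarrow> l) (at z within {-\<theta>..\<theta>})"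
      proof cases
        case 1
        then show ?thesis
          using G_left_end theta by (auto simp: at_within_Icc_at_right)
      next
        case 2
        then show ?thesis
          using G_right_end theta by (auto simp: at_within_Icc_at_left)
      next
        case 3
        then show ?thesis
          using G_interior at_I by (simp add: I_def)
      qed
    qed (use theta in auto)
    \<comment> \<open>Pulling out the constant leaves a product equal to 0 whose first factor is
      nonzero, as eigenvalues of equal parity differ.\<close>
    from integral_unique[OF this] have "(lam m - lam n) * integral I (\<lambda>x. weight C R x * \<Phi> n x * \<Phi> m x) = 0"
      by (simp only: integral_mult_right I_def diff_self)
    then show ?thesis
      using distinct_eigenvalues[OF nm True] by simp
  qed
  show "integral {-\<theta>..\<theta>} (\<lambda>x. weight C R x * \<Phi> n x * \<Phi> m x)
      = integral {-\<theta>..\<theta>} (\<lambda>x. weight C R x * (\<Phi> n x)\<^sup>2) * (if n = m then 1 else 0)"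
    using zero by (auto simp: I_def power2_eq_square mult.assoc)
qed

end
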